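(* Let $R$ be a ring of characteristic $p>0$, let $I\subseteq R$ be an ideal, and let $s,t$ be real numbers with $1\leq t<s$. Then $\left(I^{\{t\}}\right)^{\{s\}}=I^{\{t\}}$.
   Context: All rings are commutative and noetherian. $R^\circ$ denotes the set of elements of $R$ lying in no minimal prime of $R$. The letter $q$ denotes positive integer powers of $p$, and $q\gg 0$ means all sufficiently large such powers. $I^{[q]}=(f^q\mid f\in I)$ is the $q$th Frobenius power of $I$. For a real number $s\geq 1$, $I^{(s,q)}=I^{\lceil sq\rceil}+I^{[q]}$. The weak $s$-closure $I^{\{s\}}$ of $I$ is the ideal of all $x\in R$ for which there exists $c\in R^\circ$ such that $cx^q\in I^{(s,q)}$ for all $q\gg 0$. *)

theory Defs
  imports Complex_Main "HOL-Algebra.Algebra"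
begin

text \<open>The characteristic of the ring is exactly \<open>p\<close>, with the convention of \<open>CHAR\<close>.
  For prime \<open>p\<close> this excludes the zero ring, whose characteristic is \<open>1\<close>.\<close>

definition has_characteristic :: "('a, 'b) ring_scheme \<Rightarrow> nat \<Rightarrow> bool"
  where "has_characteristic R p \<longleftrightarrow> (\<forall>n::nat. [n] \<cdot>\<^bsub>R\<^esub> \<one>\<^bsub>R\<^esub> = \<zero>\<^bsub>R\<^esub> \<longleftrightarrow> p dvd n)"

definition minimal_prime :: "('a, 'b) ring_scheme \<Rightarrow> 'a set \<Rightarrow> bool"
  where "minimal_prime R P \<longleftrightarrow>
    primeideal P R \<and> (\<forall>Q. primeideal Q R \<and> Q \<subseteq> P \<longrightarrow> Q = P)"

text \<open>\<open>R\<^sup>\<circ>\<close>\<close>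

definition outside_minimal_primes :: "('a, 'b) ring_scheme \<Rightarrow> 'a set"
  where "outside_minimal_primes R = {c \<in> carrier R. \<forall>P. minimal_prime R P \<longrightarrow> c \<notin> P}"

text \<open>The ordinary power \<open>I\<^sup>n\<close> is the power in the multiplicative monoid of ideals;
  in particular \<open>I\<^sup>0 = carrier R\<close>.\<close>

abbreviation ideal_power :: "('a, 'b) ring_scheme \<Rightarrow> 'a set \<Rightarrow> nat \<Rightarrow> 'a set"
  where "ideal_power R I n \<equiv> I [^]\<^bsub>ideals_set R\<^esub> n"

definition frobenius_power :: "('a, 'b) ring_scheme \<Rightarrow> 'a set \<Rightarrow> nat \<Rightarrow> 'a set"
  where "frobenius_power R I q = Idl\<^bsub>R\<^esub> {f [^]\<^bsub>R\<^esub> q | f. f \<in> I}"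

text \<open>\<open>I\<^bsup>(s,q)\<^esup>\<close>; the conversion \<open>nat\<close> is harmless because \<open>s \<ge> 1\<close>.\<close>

definition mixed_power :: "('a, 'b) ring_scheme \<Rightarrow> 'a set \<Rightarrow> real \<Rightarrow> nat \<Rightarrow> 'a set"
  where "mixed_power R I s q =
    ideal_power R I (nat \<lceil>s * real q\<rceil>) <+>\<^bsub>R\<^esub> frobenius_power R I q"

text \<open>\<open>I\<^bsup>{s}\<^esup>\<close> in characteristic \<open>p\<close>. The condition for all powers \<open>q \<gg> 0\<close> of \<open>p\<close> is expressed
  through the exponent, \<open>q = p\<^sup>e\<close>. The element \<open>c\<close> does not depend on \<open>q\<close>.\<close>

definition weak_closure :: "('a, 'b) ring_scheme \<Rightarrow> nat \<Rightarrow> real \<Rightarrow> 'a set \<Rightarrow> 'a set"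
  where "weak_closure R p s I =
    {x \<in> carrier R. \<exists>c \<in> outside_minimal_primes R.
       \<forall>\<^sub>F e in sequentially. c \<otimes>\<^bsub>R\<^esub> (x [^]\<^bsub>R\<^esub> (p ^ e)) \<in> mixed_power R I s (p ^ e)}"

end

theory Submission
  imports Defs
begin

text \<open>
  Let \<open>J = I\<^bsup>{t}\<^esup>\<close>. Every ideal lies in its \<open>s\<close>-closure, with multiplier \<open>1\<close>, so the
  content is that \<open>x \<in> J\<^bsup>{s}\<^esup>\<close> implies \<open>x \<in> J\<close>. We have
  \<open>d x\<^sup>q \<in> J\<^bsup>N\<^esup> + J\<^bsup>[q]\<^esup>\<close> with \<open>N = \<lceil>sq\<rceil>\<close>, and it suffices to multiply each of the two summands
  into \<open>I\<^bsup>(t,q)\<^esup>\<close> by an element of \<open>R\<^sup>\<circ>\<close> that is independent of \<open>q\<close>.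

  The ring is noetherian, so \<open>J\<close> is generated by a finite set \<open>A\<close>, whose elements share a
  multiplier \<open>c\<close>. In characteristic \<open>p\<close> the elements \<open>f\<close> with \<open>c f\<^sup>q \<in> I\<^bsup>(t,q)\<^esup>\<close> form an ideal
  (\<open>frobenius_colon_ideal\<close>), so \<open>c\<close> serves all of \<open>J\<close> at once (\<open>uniform_multiplier\<close>), and
  \<open>c J\<^bsup>[q]\<^esup> \<subseteq> I\<^bsup>(t,q)\<^esup>\<close>.

  For \<open>J\<^bsup>N\<^esup>\<close> one would classically use that \<open>J\<close> is integral over \<open>I\<close>. Here is a direct argument.
  Fix \<open>k\<close> with \<open>card A \<le> (s - t) p\<^sup>k\<close> and put \<open>Q = q / p\<^sup>k\<close>. As \<open>t \<ge> 1\<close>, the multiplier gives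
  \<open>c x\<^bsup>Q\<^esup> \<in> I\<^bsup>Q\<^esup>\<close> for every generator \<open>x\<close>. A monomial of degree \<open>N\<close> in the generators splits off
  \<open>a\<^sub>x div Q\<close> factors \<open>x\<^bsup>Q\<^esup>\<close> from each \<open>x\<close>. These are at most \<open>M = \<lceil>s p\<^sup>k\<rceil>\<close> factors in total, and the
  degree that is left over is at most \<open>Q card A \<le> (s - t) q\<close>. Hence \<open>c\<^bsup>M\<^esup> J\<^bsup>N\<^esup> \<subseteq> I\<^bsup>\<lceil>tq\<rceil>\<^esup>\<close>
  (\<open>multiplier_power_asymptotic\<close>), where \<open>M\<close> does not depend on \<open>q\<close>. Altogether \<open>c\<^bsup>M+1\<^esup> d\<close> is a
  multiplier which shows that \<open>x \<in> J\<close>.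
\<close>

section \<open>Ideals and their powers\<close>

lemma sum_le_sum_div_mult:
  fixes a :: "'c \<Rightarrow> nat"
  assumes "Q > 0"
  shows "sum a A \<le> Q * (\<Sum>x\<in>A. a x div Q) + card A * Q"
proof -
  have "sum a A \<le> (\<Sum>x\<in>A. Q * (a x div Q) + Q)"
    using assms by (intro sum_mono) (metis add_left_mono less_or_eq_imp_le mod_less_divisor mult_div_mod_eq)
  then show ?thesis by (simp add: sum.distrib sum_distrib_left)
qed

lemma sum_div_mult_le_sum:
  fixes a :: "'c \<Rightarrow> nat"
  shows "Q * (\<Sum>x\<in>A. a x div Q) \<le> sum a A"
  unfolding sum_distrib_left by (intro sum_mono) simp

context cring
begin


lemma ideal_criterion:
  assumes "K \<subseteq> carrier R" and "\<zero> \<in> K"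
    and add: "\<And>x y. \<lbrakk>x \<in> K; y \<in> K\<rbrakk> \<Longrightarrow> x \<oplus> y \<in> K"
    and mult: "\<And>r x. \<lbrakk>r \<in> carrier R; x \<in> K\<rbrakk> \<Longrightarrow> r \<otimes> x \<in> K"
  shows "ideal K R"
proof (rule idealI)
  show "ring R" by (rule ring_axioms)
  show "subgroup K (add_monoid R)"
  proof (rule add.subgroupI)
    fix x assume x: "x \<in> K"
    then have "\<ominus> x = (\<ominus> \<one>) \<otimes> x" using assms(1) by (auto simp: l_minus)
    then show "\<ominus> x \<in> K" using mult x by simp
  qed (use assms in auto)
  show "\<And>a x. \<lbrakk>a \<in> K; x \<in> carrier R\<rbrakk> \<Longrightarrow> a \<otimes> x \<in> K"
    using mult assms(1) m_comm by (metis subsetD)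
qed (rule mult)

lemma colon_ideal:
  assumes "ideal K R" and "c \<in> carrier R"
  shows "ideal {y \<in> carrier R. c \<otimes> y \<in> K} R"
proof -
  interpret K: ideal K R by fact
  show ?thesis
    by (rule ideal_criterion)
      (use assms(2) in \<open>auto simp: r_distr m_lcomm intro: K.a_closed K.I_l_closed\<close>)
qed

lemma ideal_power_Suc:
  "ideal_power R K (Suc n) = ideal_power R K n \<cdot> K"
  by (simp add: ideals_set_def)

lemma ideal_power_ideal:
  assumes "ideal K R"
  shows "ideal (ideal_power R K n) R"
proof (induction n)
  case 0
  show ?case using oneideal by (simp add: ideals_set_def)
next
  case (Suc n)
  then show ?case
    unfolding ideal_power_Suc by (rule ideal_prod_is_ideal[OF _ assms])
qed

lemma ideal_power_add:
  assumes "ideal K R"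
  shows "ideal_power R K (m + n) = ideal_power R K m \<cdot> ideal_power R K n"
proof -
  interpret S: comm_monoid "ideals_set R" by (rule ideals_set_is_comm_monoid)
  have "K \<in> carrier (ideals_set R)" using assms by (simp add: ideals_set_def)
  then have "ideal_power R K (m + n) = ideal_power R K m \<otimes>\<^bsub>ideals_set R\<^esub> ideal_power R K n"
    by (rule S.nat_pow_mult[symmetric])
  then show ?thesis by (simp only: ideals_set_def monoid.simps)
qed

lemma ideal_power_mult_closed:
  assumes "ideal K R" "x \<in> ideal_power R K m" "y \<in> ideal_power R K n"
  shows "x \<otimes> y \<in> ideal_power R K (m + n)"
  using assms by (simp add: ideal_power_add ideal_prod.prod)

lemma ideal_power_antimono:
  assumes "ideal K R" "m \<le> n"
  shows "ideal_power R K n \<subseteq> ideal_power R K m"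
proof -
  have "ideal_power R K n = ideal_power R K m \<cdot> ideal_power R K (n - m)"
    using assms ideal_power_add[of K m "n - m"] by simp
  also have "\<dots> \<subseteq> ideal_power R K m"
    using ideal_prod_inter ideal_power_ideal assms(1) by blast
  finally show ?thesis .
qed

lemma element_pow_in_ideal_power:
  assumes "ideal K R" "x \<in> ideal_power R K m"
  shows "x [^] (n::nat) \<in> ideal_power R K (m * n)"
proof (induction n)
  case 0
  show ?case by (simp add: ideals_set_def)
next
  case (Suc n)
  then show ?case
    using ideal_power_mult_closed[OF assms(1) Suc assms(2)] by (simp add: algebra_simps)
qed

lemma ideal_power_1:
  assumes "ideal K R"
  shows "ideal_power R K (Suc 0) = K"
  using ideal_prod_commute[OF oneideal assms] ideal_prod_one[OF assms]
  by (simp add: ideals_set_def)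

lemma finprod_fun_upd_Suc:
  assumes "finite A" "A \<subseteq> carrier R" "x \<in> A"
  shows "(\<Otimes>y\<in>A. y [^] (a(x := Suc (a x))) y) = x \<otimes> (\<Otimes>y\<in>A. y [^] (a y :: nat))"
proof -
  obtain B where A: "A = insert x B" "x \<notin> B" using assms(3) mk_disjoint_insert by metis
  have [simp]: "finite B" "x \<in> carrier R" and B: "B \<subseteq> carrier R" using A assms by auto
  have eq: "(\<Otimes>y\<in>B. y [^] (a(x := Suc (a x))) y) = (\<Otimes>y\<in>B. y [^] a y)"
    using A B by (intro finprod_cong') auto
  have P: "(\<lambda>y. y [^] a y) \<in> B \<rightarrow> carrier R" "(\<lambda>y. y [^] (a(x := Suc (a x))) y) \<in> B \<rightarrow> carrier R"
    using B by auto
  then have "(\<Otimes>y\<in>B. y [^] a y) \<in> carrier R" by (rule_tac finprod_closed)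
  then show ?thesis
    using A P eq by (simp add: m_ac)
qed

text \<open>This is the statement that the monomials of degree \<open>n\<close> in \<open>A\<close> generate the \<open>n\<close>th power of the
  ideal generated by \<open>A\<close>, phrased through the ideals \<open>K\<close> that contain them. This form lets the
  induction replace \<open>K\<close> by the colon ideals \<open>(K : x)\<close>, so that no sums of monomials appear.\<close>

lemma genideal_power_subset:
  assumes "finite A" "A \<subseteq> carrier R" "ideal K R"
    and "\<And>a. sum a A = n \<Longrightarrow> (\<Otimes>y\<in>A. y [^] (a y :: nat)) \<in> K"
  shows "ideal_power R (Idl A) n \<subseteq> K"
  using assms(3,4)
proof (induction n arbitrary: K)
  case 0
  interpret K: ideal K R by fact
  have "(\<Otimes>y\<in>A. y [^] (0::nat)) \<in> K" using 0(2)[of "\<lambda>_. 0"] by simp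
  then have "K = carrier R" using K.one_imp_carrier by simp
  then show ?case by (simp add: ideals_set_def)
next
  case (Suc n)
  interpret K: ideal K R by fact
  have J: "ideal (Idl A) R" using genideal_ideal assms(2) by blast
  have Jn: "ideal (ideal_power R (Idl A) n) R" using ideal_power_ideal J by blast
  (* All monomials of degree n lie in (K : x), so the induction hypothesis applies to that ideal. *)
  have gen: "x \<otimes> y \<in> K" if "x \<in> A" "y \<in> ideal_power R (Idl A) n" for x y
  proof -
    have x: "x \<in> carrier R" using that assms(2) by blast
    have "ideal_power R (Idl A) n \<subseteq> {y \<in> carrier R. x \<otimes> y \<in> K}"
    proof (rule Suc.IH[OF colon_ideal[OF Suc.prems(1) x]])
      fix a :: "'a \<Rightarrow> nat" assume a: "sum a A = n"
      have "sum (a(x := Suc (a x))) A = Suc n"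
        using a that(1) assms(1) by (simp add: sum.remove[of A x])
      from Suc.prems(2)[OF this] finprod_fun_upd_Suc[OF assms(1,2) that(1)]
      show "(\<Otimes>y\<in>A. y [^] a y) \<in> {y \<in> carrier R. x \<otimes> y \<in> K}"
        using assms(2) by (auto intro!: finprod_closed)
    qed
    then show ?thesis using that by blast
  qed
  (* Now y is fixed instead: (K : y) contains A, hence the ideal generated by A. *)
  have prods: "y \<otimes> z \<in> K" if y: "y \<in> ideal_power R (Idl A) n" and z: "z \<in> Idl A" for y z
  proof -
    have yc: "y \<in> carrier R" using y ideal.Icarr[OF Jn] by blast
    have "A \<subseteq> {z \<in> carrier R. y \<otimes> z \<in> K}"
      using gen[OF _ y] yc assms(2) m_comm by (auto simp: subset_iff)
    then have "Idl A \<subseteq> {z \<in> carrier R. y \<otimes> z \<in> K}"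
      by (rule genideal_minimal[OF colon_ideal[OF Suc.prems(1) yc]])
    then show ?thesis using z by blast
  qed
  have "w \<in> K" if "w \<in> ideal_power R (Idl A) n \<cdot> (Idl A)" for w
    using that by (induction rule: ideal_prod.induct) (auto intro: prods K.a_closed)
  then show ?case unfolding ideal_power_Suc by blast
qed

text \<open>Each block \<open>x\<^bsup>Q\<^esup>\<close> of the monomial costs one factor \<open>c\<close> and contributes \<open>Q\<close> to the exponent of
  \<open>I\<close>; the remainders \<open>a\<^sub>x mod Q\<close> are given away.\<close>

lemma monomial_in_ideal_power:
  assumes "ideal I R" "c \<in> carrier R" "finite A" "A \<subseteq> carrier R"
    and "\<And>x. x \<in> A \<Longrightarrow> c \<otimes> x [^] Q \<in> ideal_power R I Q"
  shows "c [^] (\<Sum>x\<in>A. a x div Q) \<otimes> (\<Otimes>x\<in>A. x [^] (a x :: nat))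
    \<in> ideal_power R I (Q * (\<Sum>x\<in>A. a x div Q))"
  using assms(3,4,5)
proof (induction A rule: finite_induct)
  case empty
  show ?case by (simp add: ideals_set_def)
next
  case (insert x A)
  let ?m = "\<Sum>x\<in>A. a x div Q" and ?P = "\<Otimes>x\<in>A. x [^] a x" and ?b = "a x div Q"
  have x: "x \<in> carrier R" and A: "A \<subseteq> carrier R" using insert by auto
  have P: "?P \<in> carrier R" using A by (auto intro!: finprod_closed)
  have IH: "c [^] ?m \<otimes> ?P \<in> ideal_power R I (Q * ?m)" using insert by simp
  have cb: "(c \<otimes> x [^] Q) [^] ?b \<in> ideal_power R I (Q * ?b)"
    by (rule element_pow_in_ideal_power) (use insert assms(1) in auto)
  have xa: "x [^] a x = (x [^] Q) [^] ?b \<otimes> x [^] (a x mod Q)"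
    using x by (simp add: nat_pow_pow nat_pow_mult)
  have "(c \<otimes> x [^] Q) [^] ?b \<otimes> x [^] (a x mod Q) \<in> ideal_power R I (Q * ?b)"
    using x cb ideal.I_r_closed[OF ideal_power_ideal[OF assms(1)]] by simp
  then have "c [^] ?b \<otimes> x [^] a x \<in> ideal_power R I (Q * ?b)"
    unfolding xa using x assms(2) by (simp add: nat_pow_distrib m_assoc)
  from ideal_power_mult_closed[OF assms(1) this IH]
  have "(c [^] ?b \<otimes> x [^] a x) \<otimes> (c [^] ?m \<otimes> ?P) \<in> ideal_power R I (Q * (?b + ?m))"
    by (simp add: distrib_left)
  moreover have "(c [^] ?b \<otimes> x [^] a x) \<otimes> (c [^] ?m \<otimes> ?P) = c [^] (?b + ?m) \<otimes> (x [^] a x \<otimes> ?P)"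
    using x P assms(2) by (simp add: m_ac nat_pow_mult[symmetric])
  moreover have "(\<Otimes>x\<in>insert x A. x [^] a x) = x [^] a x \<otimes> ?P"
    using insert.hyps x A by (subst finprod_insert) auto
  ultimately show ?case using insert.hyps by simp
qed

text \<open>The quantitative form of the block argument for a single \<open>Q\<close>: a monomial of degree \<open>N\<close> has at
  most \<open>N / Q \<le> M\<close> blocks, and the remainders account for a degree of at most \<open>card A * Q\<close>.\<close>

lemma multiplier_power_genideal:
  assumes "ideal I R" "c \<in> carrier R" "finite A" "A \<subseteq> carrier R" "Q > 0"
    and "\<And>x. x \<in> A \<Longrightarrow> c \<otimes> x [^] Q \<in> ideal_power R I Q"
    and "N \<le> Q * M" and "m + card A * Q \<le> N" and "y \<in> ideal_power R (Idl A) N"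
  shows "c [^] M \<otimes> y \<in> ideal_power R I m"
proof -
  let ?K = "{y \<in> carrier R. c [^] M \<otimes> y \<in> ideal_power R I m}"
  have Im: "ideal (ideal_power R I m) R" using ideal_power_ideal assms(1) by blast
  have "ideal_power R (Idl A) N \<subseteq> ?K"
  proof (rule genideal_power_subset[OF assms(3,4)])
    show "ideal ?K R" using colon_ideal[OF Im] assms(2) by simp
    fix a :: "'a \<Rightarrow> nat" assume a: "sum a A = N"
    let ?b = "\<Sum>x\<in>A. a x div Q" and ?P = "\<Otimes>x\<in>A. x [^] a x"
    have P: "?P \<in> carrier R" using assms(4) by (auto intro!: finprod_closed)
    have "Q * ?b \<le> Q * M" using order_trans[OF sum_div_mult_le_sum assms(7)[folded a]] .
    then have b: "?b \<le> M" using assms(5) by (metis mult_le_cancel1)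
    have "m \<le> Q * ?b" using sum_le_sum_div_mult[OF assms(5), of a A] a assms(8) by simp
    then have "c [^] ?b \<otimes> ?P \<in> ideal_power R I m"
      using monomial_in_ideal_power[OF assms(1-4,6)] ideal_power_antimono[OF assms(1)] by blast
    then have "c [^] (M - ?b) \<otimes> (c [^] ?b \<otimes> ?P) \<in> ideal_power R I m"
      using ideal.I_l_closed[OF Im] assms(2) by blast
    moreover have "c [^] (M - ?b) \<otimes> (c [^] ?b \<otimes> ?P) = c [^] M \<otimes> ?P"
      using b P assms(2) by (simp add: m_assoc[symmetric] nat_pow_mult)
    ultimately show "?P \<in> ?K" using P by simp
  qed
  then show ?thesis using assms(9) by blast
qed

section \<open>The Frobenius endomorphism\<close>

lemma binomial_theorem:
  assumes x: "x \<in> carrier R" and y: "y \<in> carrier R"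
  shows "(x \<oplus> y) [^] (n::nat) = (\<Oplus>k\<in>{..n}. [(n choose k)] \<cdot> (x [^] k \<otimes> y [^] (n - k)))"
proof (induction n)
  case 0
  show ?case by simp
next
  case (Suc n)
  define T where "T n k = [(n choose k)] \<cdot> (x [^] k \<otimes> y [^] (n - k))" for n k :: nat
  have T: "T n k \<in> carrier R" for n k using x y by (simp add: T_def)
  (* For k = n the exponent n - Suc k is truncated, but then the binomial coefficient vanishes. *)
  have pascal: "T (Suc n) (Suc k) = x \<otimes> T n k \<oplus> y \<otimes> T n (Suc k)" if "k \<le> n" for k
  proof -
    have 1: "x \<otimes> T n k = [(n choose k)] \<cdot> (x [^] Suc k \<otimes> y [^] (n - k))"
      using x y by (simp add: T_def add_pow_rdistr m_ac)
    have 2: "y \<otimes> T n (Suc k) = [(n choose Suc k)] \<cdot> (x [^] Suc k \<otimes> y [^] (n - k))"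
    proof (cases "k = n")
      case True
      then show ?thesis using x y by (simp add: T_def binomial_eq_0)
    next
      case False
      then have "n - k = Suc (n - Suc k)" using that by simp
      then show ?thesis using x y by (simp add: T_def add_pow_rdistr m_ac)
    qed
    show ?thesis unfolding 1 2 using x y by (simp add: T_def add.nat_pow_mult)
  qed
  have "(\<Oplus>k\<in>{..Suc n}. T (Suc n) k) = (\<Oplus>k\<in>{..n}. T (Suc n) (Suc k)) \<oplus> T (Suc n) 0"
    using T by (intro add.finprod_Suc2) auto
  also have "(\<Oplus>k\<in>{..n}. T (Suc n) (Suc k)) = (\<Oplus>k\<in>{..n}. x \<otimes> T n k \<oplus> y \<otimes> T n (Suc k))"
    using T x y pascal by (intro add.finprod_cong') auto
  also have "\<dots> = (\<Oplus>k\<in>{..n}. x \<otimes> T n k) \<oplus> (\<Oplus>k\<in>{..n}. y \<otimes> T n (Suc k))"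
    using T x y by (intro add.finprod_multf) auto
  also have "T (Suc n) 0 = y \<otimes> T n 0"
    using x y by (simp add: T_def m_ac)
  also have "(\<Oplus>k\<in>{..n}. x \<otimes> T n k) \<oplus> (\<Oplus>k\<in>{..n}. y \<otimes> T n (Suc k)) \<oplus> y \<otimes> T n 0
    = (\<Oplus>k\<in>{..n}. x \<otimes> T n k) \<oplus> (\<Oplus>k\<in>{..Suc n}. y \<otimes> T n k)"
    using T x y add.finprod_Suc2[of "\<lambda>k. y \<otimes> T n k" n] by (simp add: a_assoc Pi_def)
  also have "(\<Oplus>k\<in>{..Suc n}. y \<otimes> T n k) = (\<Oplus>k\<in>{..n}. y \<otimes> T n k)"
    using T x y by (simp add: Pi_def) (simp add: T_def binomial_eq_0)
  also have "(\<Oplus>k\<in>{..n}. x \<otimes> T n k) = x \<otimes> (\<Oplus>k\<in>{..n}. T n k)"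
    using T x by (intro finsum_rdistr[symmetric]) auto
  also have "(\<Oplus>k\<in>{..n}. y \<otimes> T n k) = y \<otimes> (\<Oplus>k\<in>{..n}. T n k)"
    using T y by (intro finsum_rdistr[symmetric]) auto
  also have "x \<otimes> (\<Oplus>k\<in>{..n}. T n k) \<oplus> y \<otimes> (\<Oplus>k\<in>{..n}. T n k) = (x \<oplus> y) [^] n \<otimes> (x \<oplus> y)"
    using T x y Suc by (simp add: T_def[symmetric] l_distr[symmetric] m_comm Pi_def)
  finally show ?case by (simp add: T_def)
qed

lemma freshmans_dream:
  assumes p: "Factorial_Ring.prime (p::nat)" and char: "[p] \<cdot> \<one> = \<zero>"
    and x: "x \<in> carrier R" and y: "y \<in> carrier R"
  shows "(x \<oplus> y) [^] p = x [^] p \<oplus> y [^] p"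
proof -
  define T where "T k = [(p choose k)] \<cdot> (x [^] k \<otimes> y [^] (p - k))" for k
  have T: "T k \<in> carrier R" for k using x y by (simp add: T_def)
  have p0: "p > 0" using p prime_gt_0_nat by blast
  (* The prime p divides the inner binomial coefficients. *)
  have vanish: "T k = \<zero>" if "0 < k" "k < p" for k
  proof -
    have "p dvd (p choose k)" using that p by (intro dvd_choose_prime) auto
    then obtain m where m: "p choose k = p * m" by (elim dvdE)
    have "[p] \<cdot> z = \<zero>" if "z \<in> carrier R" for z
      using add_pow_ldistr[of \<one> z p] char that by simp
    then show ?thesis
      using x y by (simp add: T_def m add.nat_pow_pow[symmetric])
  qed
  have "(x \<oplus> y) [^] p = (\<Oplus>k\<in>{..p}. T k)"
    unfolding T_def by (rule binomial_theorem[OF x y])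
  also have "\<dots> = (\<Oplus>k\<in>{0, p}. T k)"
    using T vanish by (intro add.finprod_mono_neutral_cong_right) auto
  also have "\<dots> = y [^] p \<oplus> x [^] p"
    using T p0 x y by (simp add: Pi_def) (simp add: T_def)
  finally show ?thesis using x y by (simp add: a_comm)
qed

lemma frobenius_add:
  assumes p: "Factorial_Ring.prime (p::nat)" and char: "[p] \<cdot> \<one> = \<zero>"
    and x: "x \<in> carrier R" and y: "y \<in> carrier R"
  shows "(x \<oplus> y) [^] (p ^ e) = x [^] (p ^ e) \<oplus> y [^] (p ^ e)"
proof (induction e)
  case 0
  show ?case using x y by simp
next
  case (Suc e)
  have pw: "z [^] (p ^ Suc e) = (z [^] (p ^ e)) [^] p" if "z \<in> carrier R" for z
    using that by (simp add: nat_pow_pow mult.commute)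
  show ?case
    using x y Suc freshmans_dream[OF p char] by (simp del: power_Suc add: pw)
qed

text \<open>Membership conditions of the form \<open>c f\<^sup>q \<in> K\<close> need only be checked on generators,
  because taking \<open>q\<close>th powers is additive in characteristic \<open>p\<close>.\<close>

lemma frobenius_colon_ideal:
  assumes p: "Factorial_Ring.prime (p::nat)" and char: "[p] \<cdot> \<one> = \<zero>"
    and "ideal K R" and c: "c \<in> carrier R"
  shows "ideal {f \<in> carrier R. c \<otimes> f [^] (p ^ e) \<in> K} R"
proof -
  interpret K: ideal K R by fact
  have "p ^ e > 0" using p prime_gt_0_nat by simp
  then have z: "\<zero> [^] (p ^ e) = \<zero>" by (simp add: nat_pow_zero)
  show ?thesis
  proof (rule ideal_criterion)
    fix r f assume r: "r \<in> carrier R" and f: "f \<in> {f \<in> carrier R. c \<otimes> f [^] (p ^ e) \<in> K}"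
    then have "r [^] (p ^ e) \<otimes> (c \<otimes> f [^] (p ^ e)) \<in> K" by (auto intro: K.I_l_closed)
    then show "r \<otimes> f \<in> {f \<in> carrier R. c \<otimes> f [^] (p ^ e) \<in> K}"
      using r f c by (simp add: nat_pow_distrib m_lcomm)
  qed (use c z in \<open>auto simp: frobenius_add[OF p char] r_distr intro: K.a_closed\<close>)
qed

section \<open>Frobenius powers and mixed powers\<close>

lemma frobenius_power_ideal:
  assumes "ideal I R"
  shows "ideal (frobenius_power R I q) R"
  unfolding frobenius_power_def
  using ideal.Icarr[OF assms] by (intro genideal_ideal) auto

lemma pow_in_frobenius_power:
  assumes "ideal I R" "f \<in> I"
  shows "f [^] q \<in> frobenius_power R I q"
  unfolding frobenius_power_def
  using assms ideal.Icarr[OF assms(1)]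
  by (intro subsetD[OF genideal_self]) auto

lemma mixed_power_ideal:
  assumes "ideal I R"
  shows "ideal (mixed_power R I s q) R"
  unfolding mixed_power_def
  by (intro add_ideals ideal_power_ideal frobenius_power_ideal assms)

lemma mixed_power_memE:
  assumes "z \<in> mixed_power R I s q"
  obtains u v where "u \<in> ideal_power R I (nat \<lceil>s * real q\<rceil>)" "v \<in> frobenius_power R I q" "z = u \<oplus> v"
  using assms unfolding mixed_power_def set_add_def' by blast

lemma ideal_power_subset_mixed_power:
  assumes "ideal I R"
  shows "ideal_power R I (nat \<lceil>s * real q\<rceil>) \<subseteq> mixed_power R I s q"
proof
  fix u assume u: "u \<in> ideal_power R I (nat \<lceil>s * real q\<rceil>)"
  have "\<zero> \<in> frobenius_power R I q"
    using frobenius_power_ideal[OF assms] additive_subgroup.zero_closed ideal.axioms(1) by blast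
  moreover have "u \<in> carrier R" using u ideal.Icarr[OF ideal_power_ideal[OF assms]] by blast
  ultimately show "u \<in> mixed_power R I s q"
    using u unfolding mixed_power_def set_add_def' by force
qed

lemma frobenius_power_subset_mixed_power:
  assumes "ideal I R"
  shows "frobenius_power R I q \<subseteq> mixed_power R I s q"
proof
  fix u assume u: "u \<in> frobenius_power R I q"
  have "\<zero> \<in> ideal_power R I (nat \<lceil>s * real q\<rceil>)"
    using ideal_power_ideal[OF assms] additive_subgroup.zero_closed ideal.axioms(1) by blast
  moreover have "u \<in> carrier R" using u ideal.Icarr[OF frobenius_power_ideal[OF assms]] by blast
  ultimately show "u \<in> mixed_power R I s q"
    using u unfolding mixed_power_def set_add_def' by force
qed

lemma frobenius_power_subset_ideal_power:
  assumes "ideal I R"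
  shows "frobenius_power R I q \<subseteq> ideal_power R I q"
  unfolding frobenius_power_def
proof (rule genideal_minimal[OF ideal_power_ideal[OF assms]])
  show "{f [^] q |f. f \<in> I} \<subseteq> ideal_power R I q"
    using element_pow_in_ideal_power[OF assms, of _ "Suc 0" q] ideal_power_1[OF assms] by auto
qed

lemma mixed_power_subset_ideal_power:
  assumes "ideal I R" "1 \<le> t"
  shows "mixed_power R I t q \<subseteq> ideal_power R I q"
proof
  fix z assume "z \<in> mixed_power R I t q"
  then obtain u v where uv: "u \<in> ideal_power R I (nat \<lceil>t * real q\<rceil>)" "v \<in> frobenius_power R I q" "z = u \<oplus> v"
    by (rule mixed_power_memE)
  have "real q \<le> t * real q" using assms(2) mult_right_mono[of 1 t "real q"] by simp
  then have "q \<le> nat \<lceil>t * real q\<rceil>" by linarith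
  then show "z \<in> ideal_power R I q"
    using uv ideal_power_antimono[OF assms(1)] frobenius_power_subset_ideal_power[OF assms(1)]
      ideal_power_ideal[OF assms(1)] by (meson additive_subgroup.a_closed ideal.axioms(1) subsetD)
qed

section \<open>The weak closure\<close>

lemma outside_minimal_primes_carrier:
  "c \<in> outside_minimal_primes R \<Longrightarrow> c \<in> carrier R"
  by (simp add: outside_minimal_primes_def)

lemma one_outside_minimal_primes: "\<one> \<in> outside_minimal_primes R"
proof -
  have "\<one> \<notin> P" if "minimal_prime R P" for P
  proof -
    have "primeideal P R" using that by (simp add: minimal_prime_def)
    then show ?thesis
      using ideal.one_imp_carrier[OF primeideal.axioms(1)] primeideal.I_notcarr by metis
  qed
  then show ?thesis by (simp add: outside_minimal_primes_def)
qed

lemma mult_outside_minimal_primes: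
  assumes "c \<in> outside_minimal_primes R" "d \<in> outside_minimal_primes R"
  shows "c \<otimes> d \<in> outside_minimal_primes R"
proof -
  have cd: "c \<in> carrier R" "d \<in> carrier R" using assms by (auto simp: outside_minimal_primes_def)
  have "c \<otimes> d \<notin> P" if P: "minimal_prime R P" for P
  proof -
    have "primeideal P R" using P by (simp add: minimal_prime_def)
    then show ?thesis
      using primeideal.I_prime[OF _ cd] assms P by (auto simp: outside_minimal_primes_def)
  qed
  then show ?thesis using cd by (simp add: outside_minimal_primes_def)
qed

lemma pow_outside_minimal_primes:
  assumes "c \<in> outside_minimal_primes R"
  shows "c [^] (n::nat) \<in> outside_minimal_primes R"
  by (induction n) (auto intro: one_outside_minimal_primes mult_outside_minimal_primes assms)

lemma weak_closure_memI:
  assumes "x \<in> carrier R" "c \<in> outside_minimal_primes R"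
    and "\<forall>\<^sub>F e in sequentially. c \<otimes> x [^] (p ^ e) \<in> mixed_power R I s (p ^ e)"
  shows "x \<in> weak_closure R p s I"
  using assms unfolding weak_closure_def by blast

lemma subset_weak_closure:
  assumes "ideal I R"
  shows "I \<subseteq> weak_closure R p s I"
proof
  fix x assume x: "x \<in> I"
  then have "\<one> \<otimes> x [^] (p ^ e) \<in> mixed_power R I s (p ^ e)" for e
    using pow_in_frobenius_power[OF assms x] frobenius_power_subset_mixed_power[OF assms]
      ideal.Icarr[OF assms x] by (metis l_one nat_pow_closed subsetD)
  then show "x \<in> weak_closure R p s I"
    by (intro weak_closure_memI[OF ideal.Icarr[OF assms x] one_outside_minimal_primes] always_eventually allI)
qed

lemma common_multiplier:
  assumes "ideal I R" "finite A" "A \<subseteq> weak_closure R p t I"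
  shows "\<exists>c \<in> outside_minimal_primes R.
    \<forall>\<^sub>F e in sequentially. \<forall>x\<in>A. c \<otimes> x [^] (p ^ e) \<in> mixed_power R I t (p ^ e)"
  using assms(2,3)
proof (induction A rule: finite_induct)
  case empty
  show ?case using one_outside_minimal_primes by auto
next
  case (insert x A)
  then obtain c where c: "c \<in> outside_minimal_primes R"
    and cA: "\<forall>\<^sub>F e in sequentially. \<forall>x\<in>A. c \<otimes> x [^] (p ^ e) \<in> mixed_power R I t (p ^ e)"
    by auto
  from insert obtain d where d: "d \<in> outside_minimal_primes R"
    and dx: "\<forall>\<^sub>F e in sequentially. d \<otimes> x [^] (p ^ e) \<in> mixed_power R I t (p ^ e)"
    unfolding weak_closure_def by auto
  have car: "c \<in> carrier R" "d \<in> carrier R" "insert x A \<subseteq> carrier R"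
    using c d insert.prems outside_minimal_primes_carrier unfolding weak_closure_def by auto
  have "\<forall>\<^sub>F e in sequentially. \<forall>y\<in>insert x A. (c \<otimes> d) \<otimes> y [^] (p ^ e) \<in> mixed_power R I t (p ^ e)"
    using cA dx
  proof eventually_elim
    case (elim e)
    interpret K: ideal "mixed_power R I t (p ^ e)" R by (rule mixed_power_ideal[OF assms(1)])
    have "(c \<otimes> d) \<otimes> x [^] (p ^ e) = c \<otimes> (d \<otimes> x [^] (p ^ e))"
      using car by (simp add: m_assoc)
    moreover have "(c \<otimes> d) \<otimes> y [^] (p ^ e) = d \<otimes> (c \<otimes> y [^] (p ^ e))" if "y \<in> A" for y
      using car that by (auto simp: m_assoc m_lcomm subset_iff)
    ultimately show ?case using elim car by (metis K.I_l_closed insertE)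
  qed
  then show ?case using mult_outside_minimal_primes[OF c d] by blast
qed

lemma weak_closure_ideal:
  assumes p: "Factorial_Ring.prime (p::nat)" and char: "[p] \<cdot> \<one> = \<zero>" and I: "ideal I R"
  shows "ideal (weak_closure R p t I) R"
proof (rule ideal_criterion)
  show sub: "weak_closure R p t I \<subseteq> carrier R" by (auto simp: weak_closure_def)
  show "\<zero> \<in> weak_closure R p t I"
    using subset_weak_closure[OF I] I additive_subgroup.zero_closed ideal.axioms(1) by blast
  (* Both closure properties say that z lies in every ideal that contains certain finitely many
     elements of the closure. Such a z inherits a common multiplier of these elements. *)
  have *: "z \<in> weak_closure R p t I"
    if A: "finite A" "A \<subseteq> weak_closure R p t I"
      and z: "\<And>K. ideal K R \<Longrightarrow> A \<subseteq> K \<Longrightarrow> z \<in> K" for A z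
  proof -
    obtain c where c: "c \<in> outside_minimal_primes R"
      and cA: "\<forall>\<^sub>F e in sequentially. \<forall>x\<in>A. c \<otimes> x [^] (p ^ e) \<in> mixed_power R I t (p ^ e)"
      using common_multiplier[OF I A] by blast
    have "\<forall>\<^sub>F e in sequentially. c \<otimes> z [^] (p ^ e) \<in> mixed_power R I t (p ^ e)"
      using cA
    proof eventually_elim
      case (elim e)
      have "ideal {f \<in> carrier R. c \<otimes> f [^] (p ^ e) \<in> mixed_power R I t (p ^ e)} R"
        by (intro frobenius_colon_ideal p char mixed_power_ideal I outside_minimal_primes_carrier c)
      from z[OF this] show ?case using elim A(2) sub by auto
    qed
    moreover have "z \<in> carrier R" using z[OF oneideal] A(2) sub by blast
    ultimately show ?thesis using c weak_closure_memI by blast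
  qed
  show "x \<oplus> y \<in> weak_closure R p t I"
    if "x \<in> weak_closure R p t I" "y \<in> weak_closure R p t I" for x y
    by (rule *[of "{x, y}"])
      (use that in \<open>auto intro: additive_subgroup.a_closed ideal.axioms(1)\<close>)
  show "r \<otimes> x \<in> weak_closure R p t I"
    if "r \<in> carrier R" "x \<in> weak_closure R p t I" for r x
    by (rule *[of "{x}"]) (use that in \<open>auto intro: ideal.I_l_closed\<close>)
qed

text \<open>Both the multiplier and the threshold for \<open>q\<close> can be chosen for all elements of the closure
  simultaneously, because a finite set of generators determines them.\<close>

lemma uniform_multiplier:
  assumes p: "Factorial_Ring.prime (p::nat)" and char: "[p] \<cdot> \<one> = \<zero>" and I: "ideal I R"
    and A: "finite A" "A \<subseteq> carrier R" "weak_closure R p t I = Idl A"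
  obtains c where "c \<in> outside_minimal_primes R"
    "\<forall>\<^sub>F e in sequentially. \<forall>x\<in>weak_closure R p t I. c \<otimes> x [^] (p ^ e) \<in> mixed_power R I t (p ^ e)"
proof -
  have "A \<subseteq> weak_closure R p t I" using A genideal_self by simp
  then obtain c where c: "c \<in> outside_minimal_primes R"
    and cA: "\<forall>\<^sub>F e in sequentially. \<forall>x\<in>A. c \<otimes> x [^] (p ^ e) \<in> mixed_power R I t (p ^ e)"
    using common_multiplier[OF I A(1)] by blast
  have "\<forall>\<^sub>F e in sequentially. \<forall>x\<in>weak_closure R p t I. c \<otimes> x [^] (p ^ e) \<in> mixed_power R I t (p ^ e)"
    using cA
  proof eventually_elim
    case (elim e)
    have "ideal {f \<in> carrier R. c \<otimes> f [^] (p ^ e) \<in> mixed_power R I t (p ^ e)} R"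
      by (intro frobenius_colon_ideal p char mixed_power_ideal I outside_minimal_primes_carrier c)
    from genideal_minimal[OF this, of A] show ?case using elim A by auto
  qed
  with c that show thesis by blast
qed

lemma frobenius_power_subset_colon:
  assumes "ideal K R" "c \<in> carrier R" "J \<subseteq> carrier R" "\<And>x. x \<in> J \<Longrightarrow> c \<otimes> x [^] q \<in> K"
    and "v \<in> frobenius_power R J q"
  shows "c \<otimes> v \<in> K"
proof -
  have "frobenius_power R J q \<subseteq> {y \<in> carrier R. c \<otimes> y \<in> K}"
    unfolding frobenius_power_def
    by (rule genideal_minimal[OF colon_ideal[OF assms(1,2)]]) (use assms(3,4) in auto)
  then show ?thesis using assms(5) by blast
qed

text \<open>The gap between \<open>s\<close> and \<open>t\<close> pays for the remainders: with blocks of length \<open>Q = q / p\<^sup>k\<close> their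
  total degree is at most \<open>q card A / p\<^sup>k\<close>, which is at most \<open>(s - t) q\<close> for a fixed large \<open>k\<close>. The
  number of blocks is bounded in terms of \<open>s\<close> and \<open>p\<^sup>k\<close> only, so the exponent \<open>M\<close> is uniform in \<open>q\<close>.\<close>

lemma multiplier_power_asymptotic:
  assumes p: "Factorial_Ring.prime (p::nat)" and I: "ideal I R" and t: "1 \<le> t" "t < s"
    and A: "finite A" "A \<subseteq> carrier R" and c: "c \<in> carrier R"
    and cA: "\<forall>\<^sub>F e in sequentially. \<forall>x\<in>A. c \<otimes> x [^] (p ^ e) \<in> mixed_power R I t (p ^ e)"
  obtains M :: nat where "\<forall>\<^sub>F e in sequentially.
    \<forall>y \<in> ideal_power R (Idl A) (nat \<lceil>s * real (p ^ e)\<rceil>).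
      c [^] M \<otimes> y \<in> ideal_power R I (nat \<lceil>t * real (p ^ e)\<rceil>)"
proof -
  have p1: "real p > 1" using p prime_gt_1_nat by simp
  obtain k where "real (card A) / (s - t) < real p ^ k"
    using real_arch_pow[OF p1] by blast
  then have k: "real (card A) \<le> (s - t) * real p ^ k"
    using t by (simp add: field_simps)
  define M where "M = nat \<lceil>s * real (p ^ k)\<rceil>"
  from cA obtain e0 where e0: "\<And>e x. e \<ge> e0 \<Longrightarrow> x \<in> A \<Longrightarrow> c \<otimes> x [^] (p ^ e) \<in> mixed_power R I t (p ^ e)"
    unfolding eventually_sequentially by blast
  (* The threshold is shifted by k because the multiplier is used at Q = p ^ (e - k). *)
  have "c [^] M \<otimes> y \<in> ideal_power R I (nat \<lceil>t * real (p ^ e)\<rceil>)"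
    if e: "e \<ge> e0 + k" and y: "y \<in> ideal_power R (Idl A) (nat \<lceil>s * real (p ^ e)\<rceil>)" for e y
  proof (rule multiplier_power_genideal[OF I c A _ _ _ _ y])
    let ?Q = "p ^ (e - k)"
    have q: "p ^ e = ?Q * p ^ k" using e by (simp flip: power_add)
    show "?Q > 0" using p prime_gt_0_nat by simp
    show "c \<otimes> x [^] ?Q \<in> ideal_power R I ?Q" if "x \<in> A" for x
      using e0[of "e - k" x] e that mixed_power_subset_ideal_power[OF I t(1)] by fastforce
    have "s * real (p ^ k) \<le> real M" unfolding M_def by linarith
    then have "real ?Q * (s * real (p ^ k)) \<le> real ?Q * real M" by (rule mult_left_mono) simp
    then have "s * real (p ^ e) \<le> real (?Q * M)" unfolding q by (simp add: mult_ac)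
    then show "nat \<lceil>s * real (p ^ e)\<rceil> \<le> ?Q * M" by linarith
    have "real ?Q * real (card A) \<le> real ?Q * ((s - t) * real p ^ k)"
      using k by (intro mult_left_mono) auto
    then have "t * real (p ^ e) + real (card A * ?Q) \<le> s * real (p ^ e)"
      unfolding q by (simp add: algebra_simps)
    moreover have "0 \<le> t * real (p ^ e)" using t by simp
    ultimately show "nat \<lceil>t * real (p ^ e)\<rceil> + card A * ?Q \<le> nat \<lceil>s * real (p ^ e)\<rceil>"
      by linarith
  qed
  then show thesis using that[of M] unfolding eventually_sequentially by blast
qed

end

theorem lemma4p9:
  fixes R :: "('a, 'b) ring_scheme" and p :: nat and I :: "'a set" and s t :: real
  assumes "cring R"
    and "noetherian_ring R"
    and "Factorial_Ring.prime p"
    and "has_characteristic R p"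
    and "ideal I R"
    and "1 \<le> t" and "t < s"
  shows "weak_closure R p s (weak_closure R p t I) = weak_closure R p t I"
proof
  interpret cring R by fact
  note p = assms(3) and I = assms(5)
  have char: "[p] \<cdot>\<^bsub>R\<^esub> \<one>\<^bsub>R\<^esub> = \<zero>\<^bsub>R\<^esub>"
    using assms(4) by (simp add: has_characteristic_def)
  define J where "J = weak_closure R p t I"
  have J: "ideal J R" unfolding J_def by (rule weak_closure_ideal[OF p char I])
  show "weak_closure R p t I \<subseteq> weak_closure R p s (weak_closure R p t I)"
    using subset_weak_closure[OF J] by (simp add: J_def)
  obtain A where A: "finite A" "A \<subseteq> carrier R" "J = Idl\<^bsub>R\<^esub> A"
    using noetherian_ring.finetely_gen[OF assms(2) J] by blast
  have JR: "J \<subseteq> carrier R" using ideal.Icarr[OF J] by blast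
  have AJ: "A \<subseteq> J" using A genideal_self by simp
  obtain c where c: "c \<in> outside_minimal_primes R"
    and cJ: "\<forall>\<^sub>F e in sequentially. \<forall>x\<in>J. c \<otimes>\<^bsub>R\<^esub> x [^]\<^bsub>R\<^esub> (p ^ e) \<in> mixed_power R I t (p ^ e)"
    using uniform_multiplier[OF p char I A(1,2)] A(3) unfolding J_def by blast
  have cR: "c \<in> carrier R" using c by (rule outside_minimal_primes_carrier)
  have "\<forall>\<^sub>F e in sequentially. \<forall>x\<in>A. c \<otimes>\<^bsub>R\<^esub> x [^]\<^bsub>R\<^esub> (p ^ e) \<in> mixed_power R I t (p ^ e)"
    using cJ by eventually_elim (use AJ in blast)
  from multiplier_power_asymptotic[OF p I assms(6,7) A(1,2) cR this] obtain M :: nat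
    where M: "\<forall>\<^sub>F e in sequentially. \<forall>y \<in> ideal_power R J (nat \<lceil>s * real (p ^ e)\<rceil>).
      c [^]\<^bsub>R\<^esub> M \<otimes>\<^bsub>R\<^esub> y \<in> ideal_power R I (nat \<lceil>t * real (p ^ e)\<rceil>)"
    unfolding A(3) by blast
  show "weak_closure R p s (weak_closure R p t I) \<subseteq> weak_closure R p t I"
  proof
    fix x assume "x \<in> weak_closure R p s (weak_closure R p t I)"
    then obtain d where x: "x \<in> carrier R" and d: "d \<in> outside_minimal_primes R"
      and dx: "\<forall>\<^sub>F e in sequentially. d \<otimes>\<^bsub>R\<^esub> x [^]\<^bsub>R\<^esub> (p ^ e) \<in> mixed_power R J s (p ^ e)"
      unfolding J_def[symmetric] unfolding weak_closure_def by blast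
    (* The factor c ^ M handles the ordinary power of J, one further c the Frobenius power. *)
    let ?b = "c [^]\<^bsub>R\<^esub> Suc M \<otimes>\<^bsub>R\<^esub> d"
    have dR: "d \<in> carrier R" using d by (rule outside_minimal_primes_carrier)
    have "\<forall>\<^sub>F e in sequentially. ?b \<otimes>\<^bsub>R\<^esub> x [^]\<^bsub>R\<^esub> (p ^ e) \<in> mixed_power R I t (p ^ e)"
      using cJ M dx
    proof eventually_elim
      case (elim e)
      let ?K = "mixed_power R I t (p ^ e)"
      interpret K: ideal ?K R by (rule mixed_power_ideal[OF I])
      obtain u v where u: "u \<in> ideal_power R J (nat \<lceil>s * real (p ^ e)\<rceil>)"
        and v: "v \<in> frobenius_power R J (p ^ e)" and uv: "d \<otimes>\<^bsub>R\<^esub> x [^]\<^bsub>R\<^esub> (p ^ e) = u \<oplus>\<^bsub>R\<^esub> v"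
        using mixed_power_memE[OF elim(3)] .
      have uR: "u \<in> carrier R" using u ideal.Icarr[OF ideal_power_ideal[OF J]] by blast
      have vR: "v \<in> carrier R" using v ideal.Icarr[OF frobenius_power_ideal[OF J]] by blast
      have "c \<otimes>\<^bsub>R\<^esub> v \<in> ?K"
        by (rule frobenius_power_subset_colon[OF K.is_ideal cR JR _ v]) (use elim(1) in blast)
      then have 1: "c [^]\<^bsub>R\<^esub> M \<otimes>\<^bsub>R\<^esub> (c \<otimes>\<^bsub>R\<^esub> v) \<in> ?K" using cR by (auto intro: K.I_l_closed)
      have "c [^]\<^bsub>R\<^esub> M \<otimes>\<^bsub>R\<^esub> u \<in> ?K"
        using elim(2) u ideal_power_subset_mixed_power[OF I] by blast
      then have 2: "c \<otimes>\<^bsub>R\<^esub> (c [^]\<^bsub>R\<^esub> M \<otimes>\<^bsub>R\<^esub> u) \<in> ?K" using cR by (auto intro: K.I_l_closed)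
      have "?b \<otimes>\<^bsub>R\<^esub> x [^]\<^bsub>R\<^esub> (p ^ e) = c [^]\<^bsub>R\<^esub> Suc M \<otimes>\<^bsub>R\<^esub> (u \<oplus>\<^bsub>R\<^esub> v)"
        using cR dR x by (simp add: m_assoc uv[symmetric] del: nat_pow_Suc)
      also have "\<dots> = c \<otimes>\<^bsub>R\<^esub> (c [^]\<^bsub>R\<^esub> M \<otimes>\<^bsub>R\<^esub> u) \<oplus>\<^bsub>R\<^esub> c [^]\<^bsub>R\<^esub> M \<otimes>\<^bsub>R\<^esub> (c \<otimes>\<^bsub>R\<^esub> v)"
        using cR uR vR by (simp add: r_distr m_ac)
      finally show ?case using K.a_closed[OF 2 1] by simp
    qed
    moreover have "?b \<in> outside_minimal_primes R"
      by (intro mult_outside_minimal_primes pow_outside_minimal_primes c d)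
    ultimately show "x \<in> weak_closure R p t I" using x weak_closure_memI by blast
  qed
qed

end
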